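(* Let $\epsilon>0$. Let $X$ be a nonnegative random variable and let $A\sim\mathrm{Unif}(0,\epsilon)$ be independent of $X$. Then $$P(X\ge \epsilon-A)\le \frac{\mathbb E[X]}{\epsilon}.$$
   Context: $\mathrm{Unif}(0,\epsilon)$ is the uniform distribution on the interval $(0,\epsilon)$. If $X$ is nonintegrable, $\mathbb E[X]=+\infty$ and the inequality is trivial. *)

theory Defs
  imports "HOL-Probability.Probability"
begin

end

theory Submission
  imports Defs
begin

text \<open>Condition on X. By independence, once X = x is fixed, A is still uniform on (0,
  \<epsilon>), so it lands in the top stretch of length x with probability at most x / \<epsilon>;
  this is \<open>emeasure_uniform_upper_tail_le\<close>. Tonelli on the product of the two laws
  averages this bound over X. Working in \<open>ennreal\<close> also covers an infinite
  expectation.\<close>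

text \<open>Inside (0, \<epsilon>) the tail is contained in an interval of length x ending at
  \<epsilon>, and the uniform density is 1 / \<epsilon>.\<close>

lemma emeasure_uniform_upper_tail_le:
  fixes x \<epsilon> :: real
  assumes "\<epsilon> > 0"
  shows "emeasure (uniform_measure lborel {0<..<\<epsilon>}) {\<epsilon> - x..} \<le> ennreal x / ennreal \<epsilon>"
proof -
  have "emeasure lborel ({0<..<\<epsilon>} \<inter> {\<epsilon> - x..}) \<le> ennreal x"
  proof (cases "x \<ge> 0")
    case True
    have "emeasure lborel ({0<..<\<epsilon>} \<inter> {\<epsilon> - x..}) \<le> emeasure lborel {\<epsilon> - x..\<epsilon>}"
      by (rule emeasure_mono) auto
    also have "\<dots> = ennreal x"
      using True by simp
    finally show ?thesis .
  next
    \<comment> \<open>For negative x, \<open>ennreal x\<close> is 0, but the tail starts beyond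
      \<epsilon>.\<close>
    case False
    then have "{0<..<\<epsilon>} \<inter> {\<epsilon> - x..} = {}"
      by auto
    then show ?thesis
      by simp
  qed
  then show ?thesis
    using assms by (simp add: emeasure_uniform_measure divide_right_mono_ennreal)
qed

theorem proposition1p4:
  fixes M :: "'a measure" and X A :: "'a \<Rightarrow> real" and \<epsilon> :: real
  assumes "prob_space M"
    and "\<epsilon> > 0"
    and "X \<in> borel_measurable M"
    and "AE \<omega> in M. 0 \<le> X \<omega>"
    and "A \<in> borel_measurable M"
    and "distr M borel A = uniform_measure lborel {0<..<\<epsilon>}"
    and "prob_space.indep_var M borel A borel X"
  shows "emeasure M {\<omega> \<in> space M. X \<omega> \<ge> \<epsilon> - A \<omega>}
           \<le> (\<integral>\<^sup>+ \<omega>. ennreal (X \<omega>) \<partial>M) / ennreal \<epsilon>"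
proof -
  interpret prob_space M by fact
  note [measurable] = assms(3,5)
  interpret DA: prob_space "distr M borel A" by (rule prob_space_distr) fact
  interpret DX: prob_space "distr M borel X" by (rule prob_space_distr) fact
  interpret P: pair_sigma_finite "distr M borel A" "distr M borel X" ..
  \<comment> \<open>The event as a region of the plane, with A as first coordinate to match the
    order in the independence hypothesis.\<close>
  define N where "N = {p :: real \<times> real. snd p \<ge> \<epsilon> - fst p}"
  have "closed N"
    unfolding N_def by (intro closed_Collect_le continuous_intros)
  then have N: "N \<in> sets (borel \<Otimes>\<^sub>M borel)"
    unfolding borel_prod by (rule borel_closed)
  have joint: "distr M borel A \<Otimes>\<^sub>M distr M borel X = distr M (borel \<Otimes>\<^sub>M borel) (\<lambda>\<omega>. (A \<omega>, X \<omega>))"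
    using assms(7) by (simp add: indep_var_distribution_eq)
  have "emeasure M {\<omega> \<in> space M. X \<omega> \<ge> \<epsilon> - A \<omega>}
      = emeasure (distr M (borel \<Otimes>\<^sub>M borel) (\<lambda>\<omega>. (A \<omega>, X \<omega>))) N"
    using N by (subst emeasure_distr) (auto intro!: arg_cong[where f = "emeasure M"] simp: N_def)
  \<comment> \<open>Tonelli with the law of X outermost: the slice of \<open>N\<close> at height x
    is a tail event for A alone.\<close>
  also have "\<dots> = (\<integral>\<^sup>+ x. emeasure (distr M borel A) ((\<lambda>a. (a, x)) -` N) \<partial>distr M borel X)"
    unfolding joint[symmetric]
    by (intro P.emeasure_pair_measure_alt2) (simp add: N cong: sets_pair_measure_cong)
  also have "\<dots> = (\<integral>\<^sup>+ x. emeasure (uniform_measure lborel {0<..<\<epsilon>}) {\<epsilon> - x..} \<partial>distr M borel X)"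
    by (intro nn_integral_cong arg_cong2[where f = emeasure]) (auto simp: assms(6) N_def)
  also have "\<dots> \<le> (\<integral>\<^sup>+ x. ennreal x / ennreal \<epsilon> \<partial>distr M borel X)"
    by (intro nn_integral_mono emeasure_uniform_upper_tail_le assms(2))
  \<comment> \<open>Change of variables from the law of X back to \<open>M\<close>; the constant
    divisor leaves the integral.\<close>
  also have "\<dots> = (\<integral>\<^sup>+ \<omega>. ennreal (X \<omega>) \<partial>M) / ennreal \<epsilon>"
    by (simp add: nn_integral_distr nn_integral_divide)
  finally show ?thesis .
qed

end
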